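(* Let $X$ be a linearly ordered set endowed with the order topology. If $X$ is first countable, then $C(X)_F$ is a subring of $TB_1(X)$.
   Context: All topological spaces are nonempty and $T_1$. $F(X)$ is the ring of all functions $X\to\mathbb{R}$ with pointwise operations. $C(X)_F$ is the ring of all $f\in F(X)$ whose set of points of discontinuity is finite. $B_1(X)$ is the subring of $F(X)$ of all pointwise limits of sequences of continuous real-valued functions on $X$. $TB_1(X)$ is the subring of $B_1(X)$ consisting of all $f\in B_1(X)$ for which there is a dense open subset $D$ of $X$ such that the restriction $f|_D$ is continuous on $D$. *)

theory Defs
  imports "HOL-Analysis.Analysis" "HOL-Algebra.Subrings"
begin

definition F_ring :: "('a::t1_space \<Rightarrow> real) ring" where
  "F_ring = \<lparr>carrier = UNIV, mult = (\<lambda>f g x. f x * g x), one = (\<lambda>_. 1),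
             zero = (\<lambda>_. 0), add = (\<lambda>f g x. f x + g x)\<rparr>"

(* The limit is spelled out because isCont requires a Hausdorff domain,
   while the spaces here are only T1. *)
definition discont_set :: "('a::t1_space \<Rightarrow> real) \<Rightarrow> 'a set" where
  "discont_set f = {x. \<not> (f \<longlongrightarrow> f x) (at x)}"

lemma discont_set_isCont:
  fixes f :: "'a::t2_space \<Rightarrow> real"
  shows "discont_set f = {x. \<not> isCont f x}"
  by (simp add: discont_set_def isCont_def)

definition C_F :: "('a::t1_space \<Rightarrow> real) set" where
  "C_F = {f. finite (discont_set f)}"

definition B1 :: "('a::t1_space \<Rightarrow> real) set" where
  "B1 = {f. \<exists>g. (\<forall>n. continuous_on UNIV (g n)) \<and> (\<forall>x. (\<lambda>n. g n x) \<longlonglongrightarrow> f x)}"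

definition TB1 :: "('a::t1_space \<Rightarrow> real) set" where
  "TB1 = {f \<in> B1. \<exists>D. open D \<and> closure D = UNIV \<and> continuous_on D f}"

definition B1_ring :: "('a::t1_space \<Rightarrow> real) ring" where
  "B1_ring = F_ring\<lparr>carrier := B1\<rparr>"

definition TB1_ring :: "('a::t1_space \<Rightarrow> real) ring" where
  "TB1_ring = B1_ring\<lparr>carrier := TB1\<rparr>"

(* The library's subring predicate does not require the ambient structure to be a ring;
   the following lemmas establish this for the structures above. *)

lemma F_ring_cring: "cring (F_ring :: ('a::t1_space \<Rightarrow> real) ring)"
proof (rule cringI)
  show "abelian_group (F_ring :: ('a \<Rightarrow> real) ring)"
  proof (rule abelian_groupI)
    fix f :: "'a \<Rightarrow> real"
    have "(\<lambda>x. - f x) \<oplus>\<^bsub>F_ring\<^esub> f = \<zero>\<^bsub>F_ring\<^esub>"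
      by (simp add: F_ring_def)
    then show "\<exists>g\<in>carrier F_ring. g \<oplus>\<^bsub>F_ring\<^esub> f = \<zero>\<^bsub>F_ring\<^esub>"
      by (intro bexI[of _ "\<lambda>x. - f x"]) (auto simp: F_ring_def)
  qed (auto simp: F_ring_def)
  show "comm_monoid (F_ring :: ('a \<Rightarrow> real) ring)"
    by unfold_locales (auto simp: F_ring_def)
qed (auto simp: F_ring_def algebra_simps)

lemma F_ring_minus: "\<ominus>\<^bsub>F_ring\<^esub> f = (\<lambda>x. - f x)"
proof -
  interpret cring "F_ring :: ('a \<Rightarrow> real) ring" by (rule F_ring_cring)
  show ?thesis
    by (rule minus_equality) (auto simp: F_ring_def)
qed

lemma B1_subring: "subring (B1 :: ('a::t1_space \<Rightarrow> real) set) F_ring"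
proof -
  interpret cring "F_ring :: ('a \<Rightarrow> real) ring" by (rule F_ring_cring)
  show ?thesis
  proof (rule subringI)
    show "\<one>\<^bsub>F_ring\<^esub> \<in> (B1 :: ('a \<Rightarrow> real) set)"
      unfolding B1_def F_ring_def by (auto intro!: exI[of _ "\<lambda>_ _. 1"])
  next
    fix f :: "'a \<Rightarrow> real" assume "f \<in> B1"
    then obtain u where "\<And>n. continuous_on UNIV (u n)" "\<And>x. (\<lambda>n. u n x) \<longlonglongrightarrow> f x"
      unfolding B1_def by blast
    then show "\<ominus>\<^bsub>F_ring\<^esub> f \<in> B1"
      unfolding B1_def F_ring_minus
      by (auto intro!: exI[of _ "\<lambda>n x. - u n x"] continuous_intros tendsto_intros)
  next
    fix f g :: "'a \<Rightarrow> real" assume "f \<in> B1" "g \<in> B1"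
    then obtain u v where "\<And>n. continuous_on UNIV (u n)" "\<And>x. (\<lambda>n. u n x) \<longlonglongrightarrow> f x"
        "\<And>n. continuous_on UNIV (v n)" "\<And>x. (\<lambda>n. v n x) \<longlonglongrightarrow> g x"
      unfolding B1_def by blast
    note lims = this
    show "f \<otimes>\<^bsub>F_ring\<^esub> g \<in> B1" unfolding B1_def F_ring_def using lims
      by (auto intro!: exI[of _ "\<lambda>n x. u n x * v n x"] continuous_intros tendsto_intros)
    show "f \<oplus>\<^bsub>F_ring\<^esub> g \<in> B1" unfolding B1_def F_ring_def using lims
      by (auto intro!: exI[of _ "\<lambda>n x. u n x + v n x"] continuous_intros tendsto_intros)
  qed (simp add: F_ring_def)
qed

lemma B1_ring_ring: "ring (B1_ring :: ('a::t1_space \<Rightarrow> real) ring)"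
  unfolding B1_ring_def
  by (rule ring.subring_is_ring[OF cring.axioms(1)[OF F_ring_cring] B1_subring])

lemma B1_ring_minus:
  assumes "f \<in> B1"
  shows "\<ominus>\<^bsub>B1_ring\<^esub> f = (\<lambda>x. - f x)"
proof -
  interpret ring "B1_ring :: ('a \<Rightarrow> real) ring" by (rule B1_ring_ring)
  show ?thesis
    using assms subringE(5)[OF B1_subring assms]
    by (intro minus_equality) (auto simp: B1_ring_def F_ring_minus, auto simp: F_ring_def)
qed

lemma dense_open_Int:
  fixes D E :: "'a::topological_space set"
  assumes "open D" "closure D = UNIV" "closure E = UNIV"
  shows "closure (D \<inter> E) = UNIV"
  using open_Int_closure_subset[OF assms(1), of E] assms
    closure_mono[of D "closure (D \<inter> E)"] by auto

lemma TB1_subring: "subring (TB1 :: ('a::t1_space \<Rightarrow> real) set) B1_ring"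
proof -
  interpret ring "B1_ring :: ('a \<Rightarrow> real) ring" by (rule B1_ring_ring)
  show ?thesis
  proof (rule subringI)
    have "\<one>\<^bsub>F_ring\<^esub> \<in> (B1 :: ('a \<Rightarrow> real) set)"
      by (rule subringE(3)[OF B1_subring])
    then show "\<one>\<^bsub>B1_ring\<^esub> \<in> (TB1 :: ('a \<Rightarrow> real) set)"
      by (auto simp: TB1_def B1_ring_def F_ring_def intro!: exI[of _ UNIV])
  next
    fix f :: "'a \<Rightarrow> real" assume f: "f \<in> TB1"
    then have "\<ominus>\<^bsub>F_ring\<^esub> f \<in> B1"
      by (intro subringE(5)[OF B1_subring]) (simp add: TB1_def)
    with f show "\<ominus>\<^bsub>B1_ring\<^esub> f \<in> TB1"
      by (auto simp: TB1_def B1_ring_minus F_ring_minus intro!: continuous_intros)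
  next
    fix f g :: "'a \<Rightarrow> real" assume "f \<in> TB1" "g \<in> TB1"
    then obtain D E where D: "open D" "closure D = UNIV" "continuous_on D f"
      and E: "open E" "closure E = UNIV" "continuous_on E g"
      and B: "f \<in> B1" "g \<in> B1"
      unfolding TB1_def by blast
    have "open (D \<inter> E)" "closure (D \<inter> E) = UNIV"
      "continuous_on (D \<inter> E) f" "continuous_on (D \<inter> E) g"
      using D E dense_open_Int[OF D(1,2) E(2)] by (blast intro: continuous_on_subset)+
    moreover have "f \<otimes>\<^bsub>F_ring\<^esub> g \<in> B1" "f \<oplus>\<^bsub>F_ring\<^esub> g \<in> B1"
      by (intro subringE(6,7)[OF B1_subring] B)+
    ultimately show "f \<otimes>\<^bsub>B1_ring\<^esub> g \<in> TB1" "f \<oplus>\<^bsub>B1_ring\<^esub> g \<in> TB1"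
      by (auto simp: TB1_def B1_ring_def F_ring_def intro!: exI[of _ "D \<inter> E"] continuous_intros)
  qed (auto simp: TB1_def B1_ring_def)
qed

lemma TB1_ring_ring: "ring (TB1_ring :: ('a::t1_space \<Rightarrow> real) ring)"
  unfolding TB1_ring_def by (rule ring.subring_is_ring[OF B1_ring_ring TB1_subring])

end

(* A linearly ordered space is completely regular, so first countability at a point a gives
   continuous functions w_n into [0,1] with w_n a = 0 and w_n x \<longrightarrow> 1 for every x \<noteq> a. If f is
   continuous off a finite set A, then multiplying the truncation of f to [-n,n] by the product of
   the functions w_n over a \<in> A removes the discontinuities, because a bounded function times a
   function tending to 0 tends to 0. The values f a lost in the limit are restored by adding
   f a * (1 - w_n) for each a \<in> A. *)

theory Submission
  imports Defs
begin

section \<open>Urysohn functions on a linearly ordered space\<close>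

lemma dyadics_dense:
  fixes x y :: real
  assumes "0 \<le> x" "x < y"
  obtains r where "r \<in> dyadics" "x < r" "r < y"
proof -
  obtain n q r where *: "real q / 2^n \<le> x" "x < real r / 2^n" "\<bar>real q / 2^n - real r / 2^n\<bar> < y - x"
    by (rule padic_rational_approximation_straddle_pos_le[of "y - x" 2 x]) (use assms in auto)
  show thesis
  proof
    show "real r / 2^n \<in> dyadics" by (auto simp: dyadics_def)
  qed (use * in linarith)+
qed

text \<open>Urysohn's construction with points in place of open sets: a strictly increasing family
  of points \<open>q r\<close> between \<open>a\<close> and \<open>b\<close>, indexed by the dyadic
  r in [0,1], defines u x as the supremum of the r with \<open>q r \<le> x\<close>. Density of the
  order supplies the midpoints of the recursion; density of the dyadics makes \<open>u\<close>
  continuous.\<close>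

lemma Urysohn_linorder_densely_ordered:
  fixes a b :: "'a::linorder_topology"
  assumes "a < b" and dense: "\<forall>c d. a \<le> c \<longrightarrow> c < d \<longrightarrow> d \<le> b \<longrightarrow> (\<exists>z. c < z \<and> z < d)"
  obtains u :: "'a \<Rightarrow> real" where "continuous_on UNIV u" "\<And>x. 0 \<le> u x" "\<And>x. u x \<le> 1"
    "\<And>x. x \<le> a \<Longrightarrow> u x = 0" "\<And>x. b \<le> x \<Longrightarrow> u x = 1"
proof -
  have "\<exists>q :: real \<Rightarrow> 'a. q 0 = a \<and> q 1 = b \<and> (\<forall>x \<in> dyadics \<inter> {0..1}. \<forall>y \<in> dyadics \<inter> {0..1}.
          x < y \<longrightarrow> a \<le> q x \<and> q x < q y \<and> q y \<le> b)"
  proof (rule recursion_on_dyadic_fractions)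
    \<comment> \<open>The relation passed to the dyadic recursion is strict order together with the
      bounds \<open>a\<close> and \<open>b\<close>, because \<open>dense\<close> speaks only of
      pairs between these two points.\<close>
    show "\<exists>z. (a \<le> x \<and> x < z \<and> z \<le> b) \<and> a \<le> z \<and> z < y \<and> y \<le> b" if xy: "a \<le> x \<and> x < y \<and> y \<le> b" for x y
    proof -
      obtain z where "x < z" "z < y" using dense xy by blast
      with xy show ?thesis by (intro exI[of _ z]) auto
    qed
  qed (use assms in auto)
  then obtain q :: "real \<Rightarrow> 'a" where q0: "q 0 = a" and q1: "q 1 = b"
    and q: "\<And>x y. x \<in> dyadics \<Longrightarrow> 0 \<le> x \<Longrightarrow> x < y \<Longrightarrow> y \<in> dyadics \<Longrightarrow> y \<le> 1 \<Longrightarrow> q x < q y"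
    by (auto simp: Ball_def)
  have dy: "0 \<in> (dyadics :: real set)" "1 \<in> (dyadics :: real set)"
    using real_in_dyadics[of 0] real_in_dyadics[of 1] by auto
  \<comment> \<open>Inserting 0 keeps the set nonempty for x below \<open>a\<close>, where no
    \<open>q r\<close> lies below x, and makes the supremum 0 there.\<close>
  define S where "S x = insert 0 {r \<in> dyadics. 0 \<le> r \<and> r \<le> 1 \<and> q r \<le> x}" for x
  define u where "u x = Sup (S x)" for x
  have bdd: "bdd_above (S x)" for x by (auto simp: S_def intro!: bdd_aboveI[of _ 1])
  have upper: "r \<le> u x" if "r \<in> dyadics" "0 \<le> r" "r \<le> 1" "q r \<le> x" for r x
    unfolding u_def by (rule cSup_upper[OF _ bdd]) (use that in \<open>simp add: S_def\<close>)
  have least: "u x \<le> t" if "0 \<le> t" "\<And>r. r \<in> dyadics \<Longrightarrow> 0 \<le> r \<Longrightarrow> r \<le> 1 \<Longrightarrow> q r \<le> x \<Longrightarrow> r \<le> t" for x t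
    unfolding u_def by (rule cSup_least) (use that in \<open>auto simp: S_def\<close>)
  have u0: "0 \<le> u x" for x unfolding u_def by (rule cSup_upper[OF _ bdd]) (simp add: S_def)
  have u1: "u x \<le> 1" for x by (rule least) auto
  show thesis
  proof
    show "continuous_on UNIV u" unfolding continuous_on_def
    proof (intro ballI order_tendstoI)
      fix x t assume t: "t < u x"
      show "\<forall>\<^sub>F y in at x. t < u y"
      \<comment> \<open>Dyadics are nonnegative here, so density applies only from 0 upwards; for
        negative t the bound \<open>u0\<close> suffices.\<close>
      proof (cases "t < 0")
        case True
        then show ?thesis using u0 by (auto intro!: always_eventually less_le_trans[of t 0])
      next
        case False
        have "\<exists>r. r \<in> dyadics \<and> 0 \<le> r \<and> r \<le> 1 \<and> q r \<le> x \<and> t < r"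
          using least[of t x] t False by force
        then obtain r where r: "r \<in> dyadics" "0 \<le> r" "r \<le> 1" "q r \<le> x" "t < r" by blast
        \<comment> \<open>Replacing r by a smaller s turns \<open>q r \<le> x\<close> into the
          strict \<open>q s < x\<close>. The open ray above \<open>q s\<close> is then a
          neighbourhood of x on which u is at least s, hence exceeds t.\<close>
        obtain s where s: "s \<in> dyadics" "t < s" "s < r" using dyadics_dense[of t r] False r by auto
        have pos: "0 \<le> s" using s False by linarith
        have le1: "s \<le> 1" using s r by linarith
        have "q s < x" using q[of s r] r s pos by auto
        moreover have "t < u y" if "q s < y" for y
          by (rule less_le_trans[OF s(2) upper[OF s(1) pos le1 less_imp_le[OF that]]])
        ultimately show ?thesis unfolding eventually_at_topological
          by (intro exI[of _ "{q s<..}"]) auto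
      qed
    next
      fix x t assume t: "u x < t"
      show "\<forall>\<^sub>F y in at x. u y < t"
      \<comment> \<open>Above 1 the bound \<open>u1\<close> decides. Otherwise the dyadic s chosen
        below t stays in [0,1], where \<open>q\<close> is controlled.\<close>
      proof (cases "1 < t")
        case True
        then show ?thesis using u1 by (auto intro!: always_eventually le_less_trans[of _ 1 t])
      next
        case False
        obtain s where s: "s \<in> dyadics" "u x < s" "s < t" using dyadics_dense[of "u x" t] u0 t by auto
        have pos: "0 \<le> s" using u0[of x] s by linarith
        \<comment> \<open>If \<open>q s \<le> x\<close>, then s would belong to \<open>S x\<close>
          while exceeding its supremum.\<close>
        have "x < q s" by (rule ccontr) (use upper[of s x] s pos False in \<open>simp add: not_less\<close>)
        moreover have "u y < t" if "y < q s" for y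
        proof -
          have "u y \<le> s"
          proof (rule least[OF pos])
            fix r assume r: "r \<in> dyadics" "0 \<le> r" "r \<le> 1" "q r \<le> y"
            show "r \<le> s" by (rule ccontr) (use q[of s r] r s pos that in auto)
          qed
          then show ?thesis using s by simp
        qed
        ultimately show ?thesis unfolding eventually_at_topological
          by (intro exI[of _ "{..<q s}"]) auto
      qed
    qed
    show "u x = 0" if "x \<le> a" for x
    proof -
      have "u x \<le> 0"
      proof (rule least)
        fix r assume r: "r \<in> dyadics" "0 \<le> r" "r \<le> 1" "q r \<le> x"
        show "r \<le> 0" by (rule ccontr) (use q[of 0 r] r that q0 dy in auto)
      qed simp
      with u0[of x] show ?thesis by simp
    qed
    show "u x = 1" if "b \<le> x" for x
      using upper[of 1 x] u1[of x] that q1 dy by auto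
  qed (use u0 u1 in auto)
qed

text \<open>Either the order is dense between \<open>a\<close> and \<open>b\<close>, or there is a
  jump: two neighbours c < d between them. A jump splits the space into two clopen rays, and a step
  function separates \<open>a\<close> from \<open>b\<close>.\<close>

lemma Urysohn_linorder:
  fixes a b :: "'a::linorder_topology"
  assumes "a < b"
  obtains u :: "'a \<Rightarrow> real" where "continuous_on UNIV u" "\<And>x. 0 \<le> u x" "\<And>x. u x \<le> 1"
    "\<And>x. x \<le> a \<Longrightarrow> u x = 0" "\<And>x. b \<le> x \<Longrightarrow> u x = 1"
proof (cases "\<forall>c d. a \<le> c \<longrightarrow> c < d \<longrightarrow> d \<le> b \<longrightarrow> (\<exists>z. c < z \<and> z < d)")
  case True
  from Urysohn_linorder_densely_ordered[OF assms this] that show thesis by metis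
next
  case False
  then obtain c d where cd: "a \<le> c" "c < d" "d \<le> b" and jump: "\<And>z. z < d \<Longrightarrow> z \<le> c"
    by (meson leI)
  define u :: "'a \<Rightarrow> real" where "u x = (if x \<le> c then 0 else 1)" for x
  show thesis
  proof
    show "continuous_on UNIV u" unfolding continuous_on_def
    proof (intro ballI tendsto_eventually)
      fix x
      show "\<forall>\<^sub>F y in at x. u y = u x"
      proof (cases "x \<le> c")
        case True
        \<comment> \<open>By the jump, the open ray below \<open>d\<close> is the closed ray up to
          \<open>c\<close>, so \<open>u\<close> is constant on it.\<close>
        then show ?thesis using cd jump unfolding eventually_at_topological
          by (intro exI[of _ "{..<d}"]) (auto simp: u_def)
      next
        case False
        then show ?thesis unfolding eventually_at_topological
          by (intro exI[of _ "{c<..}"]) (auto simp: u_def)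
      qed
    qed
  qed (use cd in \<open>auto simp: u_def\<close>)
qed

text \<open>The two sides of \<open>a\<close> are treated separately, with one function that is 1
  outside \<open>U\<close> on the right and one on the left; their maximum does both. If a side is
  empty, the constant 0 serves for it.\<close>

lemma linorder_completely_regular:
  fixes a :: "'a::linorder_topology"
  assumes "open U" "a \<in> U"
  obtains u :: "'a \<Rightarrow> real" where "continuous_on UNIV u" "\<And>x. 0 \<le> u x" "\<And>x. u x \<le> 1"
    "u a = 0" "\<And>x. x \<notin> U \<Longrightarrow> u x = 1"
proof -
  have "\<exists>u :: 'a \<Rightarrow> real. continuous_on UNIV u \<and> (\<forall>x. 0 \<le> u x \<and> u x \<le> 1) \<and> u a = 0 \<and>
          (\<forall>x. a < x \<and> x \<notin> U \<longrightarrow> u x = 1)"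
  proof (cases "\<exists>y. a < y")
    case True
    \<comment> \<open>The half-open interval leaves \<open>b\<close> itself possibly outside
      \<open>U\<close>, which agrees with a Urysohn function that is 1 from \<open>b\<close>
      onwards.\<close>
    then obtain b where b: "a < b" "{a..<b} \<subseteq> U" using open_right[OF assms] by blast
    obtain u :: "'a \<Rightarrow> real" where u: "continuous_on UNIV u" "\<And>x. 0 \<le> u x" "\<And>x. u x \<le> 1"
      "\<And>x. x \<le> a \<Longrightarrow> u x = 0" "\<And>x. b \<le> x \<Longrightarrow> u x = 1"
      using Urysohn_linorder[OF b(1)] by metis
    have "b \<le> x" if "a < x" "x \<notin> U" for x using subsetD[OF b(2), of x] that by force
    with u show ?thesis by (intro exI[of _ u]) auto
  qed (auto intro!: exI[of _ "\<lambda>_. 0"])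
  then obtain u :: "'a \<Rightarrow> real" where u: "continuous_on UNIV u" "\<And>x. 0 \<le> u x" "\<And>x. u x \<le> 1"
    "u a = 0" "\<And>x. a < x \<Longrightarrow> x \<notin> U \<Longrightarrow> u x = 1" by blast
  have "\<exists>v :: 'a \<Rightarrow> real. continuous_on UNIV v \<and> (\<forall>x. 0 \<le> v x \<and> v x \<le> 1) \<and> v a = 0 \<and>
          (\<forall>x. x < a \<and> x \<notin> U \<longrightarrow> v x = 1)"
  proof (cases "\<exists>y. y < a")
    case True
    then obtain b where b: "b < a" "{b<..a} \<subseteq> U" using open_left[OF assms] by blast
    obtain v :: "'a \<Rightarrow> real" where v: "continuous_on UNIV v" "\<And>x. 0 \<le> v x" "\<And>x. v x \<le> 1"
      "\<And>x. x \<le> b \<Longrightarrow> v x = 0" "\<And>x. a \<le> x \<Longrightarrow> v x = 1"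
      using Urysohn_linorder[OF b(1)] by metis
    have "x \<le> b" if "x < a" "x \<notin> U" for x using subsetD[OF b(2), of x] that by force
    \<comment> \<open>On the left the Urysohn function rises towards \<open>a\<close>, so it is
      reflected to vanish there.\<close>
    with v show ?thesis by (intro exI[of _ "\<lambda>x. 1 - v x"]) (auto intro!: continuous_intros)
  qed (auto intro!: exI[of _ "\<lambda>_. 0"])
  then obtain v :: "'a \<Rightarrow> real" where v: "continuous_on UNIV v" "\<And>x. 0 \<le> v x" "\<And>x. v x \<le> 1"
    "v a = 0" "\<And>x. x < a \<Longrightarrow> x \<notin> U \<Longrightarrow> v x = 1" by blast
  show thesis
  proof
    show "continuous_on UNIV (\<lambda>x. max (u x) (v x))" using u v by (intro continuous_intros)
    show "0 \<le> max (u x) (v x)" "max (u x) (v x) \<le> 1" for x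
      using u(2,3)[of x] v(2,3)[of x] by auto
    show "max (u a) (v a) = 0" using u v by simp
    show "max (u x) (v x) = 1" if "x \<notin> U" for x
    proof -
      have "x < a \<or> a < x" using that assms by (metis linorder_cases)
      then show ?thesis using that u(3,5)[of x] v(3,5)[of x] by auto
    qed
  qed
qed

text \<open>Take \<open>w n\<close> to be 0 at \<open>a\<close> and 1 outside the n-th set of a
  countable base at \<open>a\<close>. The base sets eventually avoid any given x other than
  \<open>a\<close>, so \<open>w n x\<close> is eventually 1.\<close>

lemma linorder_continuous_seq_tendsto_off_point:
  fixes a :: "'a::{linorder_topology, first_countable_topology}"
  obtains w :: "nat \<Rightarrow> 'a \<Rightarrow> real" where "\<And>n. continuous_on UNIV (w n)" "\<And>n. w n a = 0"
    "\<And>x. (\<lambda>n. w n x) \<longlonglongrightarrow> of_bool (x \<noteq> a)"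
proof -
  obtain U :: "nat \<Rightarrow> 'a set" where U: "\<And>n. open (U n)" "\<And>n. a \<in> U n"
    "\<And>S. open S \<Longrightarrow> a \<in> S \<Longrightarrow> \<forall>\<^sub>F n in sequentially. U n \<subseteq> S"
    using countable_basis_at_decseq[of a] by metis
  have "\<exists>u :: 'a \<Rightarrow> real. continuous_on UNIV u \<and> u a = 0 \<and> (\<forall>x. x \<notin> U n \<longrightarrow> u x = 1)" for n
    using linorder_completely_regular[OF U(1,2)[of n]] by metis
  then obtain w :: "nat \<Rightarrow> 'a \<Rightarrow> real" where w: "\<And>n. continuous_on UNIV (w n)" "\<And>n. w n a = 0"
    "\<And>n x. x \<notin> U n \<Longrightarrow> w n x = 1" by metis
  have "(\<lambda>n. w n x) \<longlonglongrightarrow> of_bool (x \<noteq> a)" for x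
  proof (cases "x = a")
    case False
    then have "\<forall>\<^sub>F n in sequentially. U n \<subseteq> - {x}" by (intro U(3)) auto
    then have "\<forall>\<^sub>F n in sequentially. w n x = 1" by eventually_elim (use w in auto)
    then show ?thesis using False by (simp add: tendsto_eventually)
  qed (use w in simp)
  with w that show thesis by blast
qed

section \<open>Finitely many discontinuities and the first Baire class\<close>

text \<open>The functions \<open>w\<close> enter as data on an arbitrary T1 space, so that the order
  matters only for their construction. The approximants are the \<open>g n\<close> defined in the
  proof.\<close>

lemma finite_discont_imp_B1:
  fixes f :: "'a::t1_space \<Rightarrow> real" and w :: "'a \<Rightarrow> nat \<Rightarrow> 'a \<Rightarrow> real"
  assumes fin: "finite (discont_set f)"
    and cont: "\<And>a n. a \<in> discont_set f \<Longrightarrow> continuous_on UNIV (w a n)"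
    and zero: "\<And>a n. a \<in> discont_set f \<Longrightarrow> w a n a = 0"
    and lim: "\<And>a x. a \<in> discont_set f \<Longrightarrow> (\<lambda>n. w a n x) \<longlonglongrightarrow> of_bool (x \<noteq> a)"
  shows "f \<in> B1"
proof -
  define A where "A = discont_set f"
  define t where "t n x = max (- real n) (min (real n) (f x))" for n x
  define p where "p n x = (\<Prod>a\<in>A. w a n x)" for n x
  define g where "g n x = t n x * p n x + (\<Sum>a\<in>A. f a * (1 - w a n x))" for n x
  have wlim: "(w a n \<longlongrightarrow> w a n x) (at x)" if "a \<in> A" for a n x
    using cont[of a n] that by (auto simp: A_def continuous_on_def)
  have tp: "((\<lambda>y. t n y * p n y) \<longlongrightarrow> t n x * p n x) (at x)" for n x
  proof -
    have p: "(p n \<longlongrightarrow> p n x) (at x)"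
      unfolding p_def by (intro tendsto_prod wlim)
    show ?thesis
    proof (cases "x \<in> A")
      case True
      \<comment> \<open>At a discontinuity one factor of \<open>p n\<close> vanishes, so
        \<open>p n\<close> tends to 0 there; the truncation \<open>t n\<close> is bounded by n,
        which forces the product to 0 as well.\<close>
      then have px: "p n x = 0"
        unfolding p_def using fin zero by (auto simp: A_def intro!: prod_zero)
      have "\<forall>\<^sub>F y in at x. norm (t n y) \<le> real n"
        by (rule always_eventually) (auto simp: t_def)
      then show ?thesis
        using lim_null_mult_left_bounded[of "t n" "real n" "at x" "p n"] p px by simp
    next
      case False
      then have "(f \<longlongrightarrow> f x) (at x)" by (simp add: A_def discont_set_def)
      then have "(t n \<longlongrightarrow> t n x) (at x)"
        unfolding t_def by (intro tendsto_intros)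
      with p show ?thesis by (rule tendsto_mult[rotated])
    qed
  qed
  have "continuous_on UNIV (g n)" for n
    unfolding continuous_on_def g_def by (intro ballI tendsto_add tp tendsto_intros wlim)
  moreover have "(\<lambda>n. g n x) \<longlonglongrightarrow> f x" for x
  proof -
    have "\<forall>\<^sub>F n in sequentially. \<bar>f x\<bar> \<le> real n"
      by (rule eventually_sequentiallyI[of "nat \<lceil>\<bar>f x\<bar>\<rceil>"]) linarith
    then have "\<forall>\<^sub>F n in sequentially. t n x = f x"
      by eventually_elim (auto simp: t_def)
    then have t: "(\<lambda>n. t n x) \<longlonglongrightarrow> f x" by (rule tendsto_eventually)
    \<comment> \<open>The truncation is inactive once n reaches the absolute value of f x. In the
      limit exactly one summand can contribute: the sum if x lies in \<open>A\<close>, the product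
      otherwise, and each then gives f x.\<close>
    have "(\<lambda>n. g n x) \<longlonglongrightarrow> f x * (\<Prod>a\<in>A. of_bool (x \<noteq> a)) + (\<Sum>a\<in>A. f a * (1 - of_bool (x \<noteq> a)))"
      unfolding g_def p_def by (intro tendsto_intros t lim) (auto simp: A_def)
    also have "f x * (\<Prod>a\<in>A. of_bool (x \<noteq> a)) = (if x \<in> A then 0 else f x)"
      using fin by (auto simp: A_def intro!: prod.neutral)
    also have "(\<Sum>a\<in>A. f a * (1 - of_bool (x \<noteq> a))) = (\<Sum>a\<in>A. if x = a then f a else 0)"
      by (rule sum.cong) auto
    also have "\<dots> = (if x \<in> A then f x else 0)"
      using fin by (simp add: A_def)
    finally show ?thesis by (simp split: if_splits)
  qed
  ultimately show ?thesis unfolding B1_def by blast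
qed

section \<open>Continuity on a dense open set\<close>

text \<open>Every function is continuous at an isolated point, so a discontinuity is a limit point
  of the whole space. In a T1 space it remains one after finitely many points are removed.\<close>

lemma closure_Compl_discont_set:
  fixes f :: "'a::t1_space \<Rightarrow> real"
  assumes "finite (discont_set f)"
  shows "closure (- discont_set f) = UNIV"
proof -
  have "x \<in> closure (- discont_set f)" if "x \<in> discont_set f" for x
  proof -
    have "at x \<noteq> bot" using that by (auto simp: discont_set_def)
    then have "x islimpt (discont_set f \<union> - discont_set f)"
      by (simp add: at_eq_bot_iff islimpt_UNIV_iff)
    then have "x islimpt - discont_set f" using assms islimpt_Un_finite by blast
    then show ?thesis by (simp add: closure_def)
  qed
  then show ?thesis using closure_subset by fastforce
qed

text \<open>The dense open set is the complement of the discontinuity set, open because finite sets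
  are closed in a T1 space.\<close>

lemma C_F_Int_B1_subset_TB1: "C_F \<inter> B1 \<subseteq> (TB1 :: ('a::t1_space \<Rightarrow> real) set)"
proof
  fix f :: "'a \<Rightarrow> real" assume "f \<in> C_F \<inter> B1"
  then have fin: "finite (discont_set f)" and B1: "f \<in> B1" by (auto simp: C_F_def)
  have "continuous_on (- discont_set f) f"
    unfolding continuous_on_def by (auto simp: discont_set_def intro: tendsto_within_subset)
  moreover have "open (- discont_set f)" using finite_imp_closed[OF fin] by (simp add: open_Compl)
  ultimately show "f \<in> TB1"
    using B1 closure_Compl_discont_set[OF fin] by (auto simp: TB1_def)
qed

lemma C_F_subset_TB1:
  "C_F \<subseteq> (TB1 :: ('a::{linorder_topology, first_countable_topology} \<Rightarrow> real) set)"
proof -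
  have "\<exists>w :: nat \<Rightarrow> 'a \<Rightarrow> real. (\<forall>n. continuous_on UNIV (w n)) \<and> (\<forall>n. w n a = 0) \<and>
          (\<forall>x. (\<lambda>n. w n x) \<longlonglongrightarrow> of_bool (x \<noteq> a))" for a
    using linorder_continuous_seq_tendsto_off_point[of a] by metis
  then obtain w :: "'a \<Rightarrow> nat \<Rightarrow> 'a \<Rightarrow> real" where "\<And>a n. continuous_on UNIV (w a n)"
    "\<And>a n. w a n a = 0" "\<And>a x. (\<lambda>n. w a n x) \<longlonglongrightarrow> of_bool (x \<noteq> a)" by metis
  then have "C_F \<subseteq> (B1 :: ('a \<Rightarrow> real) set)"
    by (auto simp: C_F_def intro: finite_discont_imp_B1[of _ w])
  then show ?thesis using C_F_Int_B1_subset_TB1 by blast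
qed

section \<open>The subring property\<close>

text \<open>The additive inverse of a ring structure is selected within its carrier, so shrinking
  the carrier requires a new identification with pointwise negation; closure of \<open>TB1\<close>
  and uniqueness of inverses provide it.\<close>

lemma TB1_ring_minus:
  assumes "f \<in> TB1"
  shows "\<ominus>\<^bsub>TB1_ring\<^esub> f = (\<lambda>x. - f x)"
proof -
  interpret ring "TB1_ring :: ('a \<Rightarrow> real) ring" by (rule TB1_ring_ring)
  have "\<ominus>\<^bsub>B1_ring\<^esub> f \<in> TB1" by (rule subringE(5)[OF TB1_subring assms])
  moreover have "\<ominus>\<^bsub>B1_ring\<^esub> f = (\<lambda>x. - f x)"
    using assms by (intro B1_ring_minus) (simp add: TB1_def)
  ultimately show ?thesis
    using assms by (intro minus_equality) (auto simp: TB1_ring_def B1_ring_def F_ring_def)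
qed

theorem theorem3p5:
  shows "subring (C_F :: ('a::{linorder_topology, first_countable_topology} \<Rightarrow> real) set) TB1_ring"
proof -
  interpret ring "TB1_ring :: ('a \<Rightarrow> real) ring" by (rule TB1_ring_ring)
  show ?thesis
  proof (rule subringI)
    show "C_F \<subseteq> carrier (TB1_ring :: ('a \<Rightarrow> real) ring)"
      using C_F_subset_TB1 by (simp add: TB1_ring_def)
    show "\<one>\<^bsub>TB1_ring\<^esub> \<in> (C_F :: ('a \<Rightarrow> real) set)"
      by (simp add: C_F_def discont_set_def TB1_ring_def B1_ring_def F_ring_def)
  next
    fix f :: "'a \<Rightarrow> real" assume f: "f \<in> C_F"
    then have "\<ominus>\<^bsub>TB1_ring\<^esub> f = (\<lambda>x. - f x)"
      using C_F_subset_TB1 by (intro TB1_ring_minus) auto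
    moreover have "discont_set (\<lambda>x. - f x) \<subseteq> discont_set f"
      by (auto simp: discont_set_def intro: tendsto_minus)
    ultimately show "\<ominus>\<^bsub>TB1_ring\<^esub> f \<in> C_F"
      using f finite_subset by (auto simp: C_F_def)
  next
    fix f g :: "'a \<Rightarrow> real" assume "f \<in> C_F" "g \<in> C_F"
    then have fin: "finite (discont_set f \<union> discont_set g)" by (simp add: C_F_def)
    \<comment> \<open>The limit laws show that a product or sum is discontinuous only where one of
      its arguments is.\<close>
    have "discont_set (\<lambda>x. f x * g x) \<subseteq> discont_set f \<union> discont_set g"
      "discont_set (\<lambda>x. f x + g x) \<subseteq> discont_set f \<union> discont_set g"
      by (auto simp: discont_set_def intro: tendsto_mult tendsto_add)
    then show "f \<otimes>\<^bsub>TB1_ring\<^esub> g \<in> C_F" "f \<oplus>\<^bsub>TB1_ring\<^esub> g \<in> C_F"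
      using finite_subset[OF _ fin]
      by (auto simp: C_F_def TB1_ring_def B1_ring_def F_ring_def)
  qed
qed

end
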